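(* Let $\mathcal{M}(\mathcal{G}_1),\mathcal{M}(\mathcal{G}_2)$ be two discrete Bayesian network models (on the same variables) such that $i\to k\leftarrow j$ is an unshielded collider in $\mathcal{G}_1$ but the triple $i,k,j$ is an unshielded noncollider in $\mathcal{G}_2$. Then, if $X_k$ is binary, the two models overlap (at some common point).
   Context: A discrete Bayesian network model $\mathcal{M}(\mathcal{G})$ for a directed acyclic graph $\mathcal{G}$ with vertex set $V$ is the set of strictly positive joint distributions of finite discrete random variables $X_V$ (each with at least two levels) that are Markov with respect to $\mathcal{G}$, i.e. $p(x_V)=\prod_{v\in V}p(x_v\mid x_{\mathrm{pa}(v)})$; it is regarded as a subset of the open probability simplex. In a graph, a pair of edges joining $i$ to $k$ and $k$ to $j$ is a collider at $k$ if both edges have an arrowhead at $k$, and a noncollider otherwise; it is unshielded if $i$ and $j$ are not joined by an edge. The tangent cone $C_\theta(\mathcal{M})$ of $\mathcal{M}$ at $\theta\in\mathcal{M}$ is the set of limits of sequences $\alpha_n(\theta_n-\theta)$ with $\alpha_n>0$, $\theta_n\in\mathcal{M}$, $\theta_n\to\theta$. Models $\mathcal{M}_1,\mathcal{M}_2$ overlap at a common point $\theta\in\mathcal{M}_1\cap\mathcal{M}_2$ if there exists $h\in C_\theta(\mathcal{M}_1)\cap C_\theta(\mathcal{M}_2)$ with $h\notin C_\theta(\mathcal{M}_1\cap\mathcal{M}_2)$. *)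

theory Defs
  imports "HOL-Analysis.Analysis"
begin

text \<open>
  The variables are indexed by a finite set \<open>V\<close>, and \<open>L v\<close> is the set of levels of variable \<open>v\<close>.
  A directed graph on \<open>V\<close> is a set of ordered pairs, \<open>(u, v)\<close> standing for the edge from \<open>u\<close> to \<open>v\<close>.
\<close>

definition state_space :: "'v set \<Rightarrow> ('v \<Rightarrow> 'a set) \<Rightarrow> bool" where
  "state_space V L \<longleftrightarrow> finite V \<and> (\<forall>v\<in>V. finite (L v) \<and> 2 \<le> card (L v))"

definition configs :: "'v set \<Rightarrow> ('v \<Rightarrow> 'a set) \<Rightarrow> ('v \<Rightarrow> 'a) set" where
  "configs V L = (\<Pi>\<^sub>E v\<in>V. L v)"

text \<open>
  A vector indexed by the finite set \<open>configs V L\<close> is represented by a function that vanishes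
  outside this set. On such functions the product topology of the function type, which is the
  one used for limits below, is the Euclidean topology.
\<close>

definition open_simplex :: "'c set \<Rightarrow> ('c \<Rightarrow> real) set" where
  "open_simplex X = {p. (\<forall>x\<in>X. 0 < p x) \<and> (\<forall>x. x \<notin> X \<longrightarrow> p x = 0) \<and> (\<Sum>x\<in>X. p x) = 1}"

definition marginal ::
  "'v set \<Rightarrow> ('v \<Rightarrow> 'a set) \<Rightarrow> (('v \<Rightarrow> 'a) \<Rightarrow> real) \<Rightarrow> 'v set \<Rightarrow> ('v \<Rightarrow> 'a) \<Rightarrow> real" where
  "marginal V L p A x = (\<Sum>y | y \<in> configs V L \<and> (\<forall>v\<in>A. y v = x v). p y)"

text \<open>\<open>conditional V L p A B x\<close> is $p(x_A \mid x_B)$.\<close>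

definition conditional ::
  "'v set \<Rightarrow> ('v \<Rightarrow> 'a set) \<Rightarrow> (('v \<Rightarrow> 'a) \<Rightarrow> real) \<Rightarrow> 'v set \<Rightarrow> 'v set \<Rightarrow> ('v \<Rightarrow> 'a) \<Rightarrow> real" where
  "conditional V L p A B x = marginal V L p (A \<union> B) x / marginal V L p B x"

definition dag :: "'v set \<Rightarrow> ('v \<times> 'v) set \<Rightarrow> bool" where
  "dag V G \<longleftrightarrow> G \<subseteq> V \<times> V \<and> acyclic G"

definition parents :: "('v \<times> 'v) set \<Rightarrow> 'v \<Rightarrow> 'v set" where
  "parents G v = {u. (u, v) \<in> G}"

definition bn_model ::
  "'v set \<Rightarrow> ('v \<Rightarrow> 'a set) \<Rightarrow> ('v \<times> 'v) set \<Rightarrow> (('v \<Rightarrow> 'a) \<Rightarrow> real) set" where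
  "bn_model V L G =
    {p \<in> open_simplex (configs V L).
      \<forall>x\<in>configs V L. p x = (\<Prod>v\<in>V. conditional V L p {v} (parents G v) x)}"

definition adjacent :: "('v \<times> 'v) set \<Rightarrow> 'v \<Rightarrow> 'v \<Rightarrow> bool" where
  "adjacent G u v \<longleftrightarrow> (u, v) \<in> G \<or> (v, u) \<in> G"

definition unshielded_collider :: "('v \<times> 'v) set \<Rightarrow> 'v \<Rightarrow> 'v \<Rightarrow> 'v \<Rightarrow> bool" where
  "unshielded_collider G i k j \<longleftrightarrow>
    i \<noteq> j \<and> (i, k) \<in> G \<and> (j, k) \<in> G \<and> \<not> adjacent G i j"

definition unshielded_noncollider :: "('v \<times> 'v) set \<Rightarrow> 'v \<Rightarrow> 'v \<Rightarrow> 'v \<Rightarrow> bool" where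
  "unshielded_noncollider G i k j \<longleftrightarrow>
    i \<noteq> j \<and> adjacent G i k \<and> adjacent G k j \<and> \<not> ((i, k) \<in> G \<and> (j, k) \<in> G) \<and>
    \<not> adjacent G i j"

definition tangent_cone :: "('c \<Rightarrow> real) set \<Rightarrow> ('c \<Rightarrow> real) \<Rightarrow> ('c \<Rightarrow> real) set" where
  "tangent_cone M \<theta> =
    {h. \<exists>(\<alpha> :: nat \<Rightarrow> real) (t :: nat \<Rightarrow> 'c \<Rightarrow> real).
          (\<forall>n. 0 < \<alpha> n) \<and> (\<forall>n. t n \<in> M) \<and> t \<longlonglongrightarrow> \<theta> \<and>
          (\<lambda>n. \<lambda>x. \<alpha> n * (t n x - \<theta> x)) \<longlonglongrightarrow> h}"

definition overlap_at ::
  "('c \<Rightarrow> real) set \<Rightarrow> ('c \<Rightarrow> real) set \<Rightarrow> ('c \<Rightarrow> real) \<Rightarrow> bool" where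
  "overlap_at M1 M2 \<theta> \<longleftrightarrow>
    \<theta> \<in> M1 \<inter> M2 \<and>
    (\<exists>h. h \<in> tangent_cone M1 \<theta> \<inter> tangent_cone M2 \<theta> \<and> h \<notin> tangent_cone (M1 \<inter> M2) \<theta>)"

end

theory Submission
  imports Defs
begin

text \<open>
  The models overlap at the uniform distribution. Both tangent cones there contain the sum of an
  interaction of \<open>i\<close> with \<open>k\<close> and an interaction of \<open>j\<close> with \<open>k\<close>, for example
  \<open>h(x) = uniform(x) (f(x\<^sub>i) + g(x\<^sub>j)) s(x\<^sub>k)\<close> with functions \<open>f\<close>, \<open>g\<close>, \<open>s\<close> of mean zero: all that
  this needs is an edge between \<open>i\<close> and \<open>k\<close> and an edge between \<open>j\<close> and \<open>k\<close>, in whichever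
  direction (\<open>edge_pair_tangent\<close>).

  The two models differ to second order. Since \<open>i\<close> and \<open>j\<close> are not adjacent, the local Markov
  property gives a set \<open>C\<close> without \<open>k\<close> such that \<open>i \<bottom> j | C\<close> on the first model
  (\<open>collider_separator\<close>) and a set \<open>D\<close> containing \<open>k\<close> such that \<open>i \<bottom> j | D\<close> on the second one
  (\<open>noncollider_separator\<close>). Suppose that \<open>p = uniform + \<epsilon> h + o(\<epsilon>)\<close> lies in both models and
  consider the component \<open>T = (\<Sum>x. f(x\<^sub>i) g(x\<^sub>j) p(x))\<close>, a pure interaction of \<open>i\<close> with \<open>j\<close>. Each
  independence determines \<open>T\<close> up to \<open>o(\<epsilon>\<^sup>2)\<close> as a quadratic form in the marginals of \<open>h\<close> on \<open>iS\<close>,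
  \<open>jS\<close>, \<open>ijS\<close> and \<open>S\<close> (\<open>cond_indep_second_order\<close>). Marginals of \<open>h\<close> on sets without \<open>k\<close> are zero,
  so \<open>C\<close> yields \<open>T = o(\<epsilon>\<^sup>2)\<close>. On the other hand \<open>D\<close> yields \<open>T = \<kappa> \<epsilon>\<^sup>2 + o(\<epsilon>\<^sup>2)\<close>, where \<open>\<kappa>\<close> is a
  positive multiple of \<open>\<Sum>x. f(x\<^sub>i)\<^sup>2 g(x\<^sub>j)\<^sup>2 s(x\<^sub>k)\<^sup>2\<close>: varying \<open>k\<close> along \<open>h\<close> moves \<open>i\<close> and \<open>j\<close>
  together. The two predictions contradict each other, so \<open>h\<close> is not tangent to the intersection
  of the models (\<open>edge_pair_not_tangent\<close>).
\<close>

section \<open>Marginalising over finitely many discrete variables\<close>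

locale discrete_variables =
  fixes V :: "'v set" and L :: "'v \<Rightarrow> 'a set"
  assumes state_space: "state_space V L"
begin

abbreviation X :: "('v \<Rightarrow> 'a) set" where "X \<equiv> configs V L"

abbreviation marg :: "(('v \<Rightarrow> 'a) \<Rightarrow> real) \<Rightarrow> 'v set \<Rightarrow> ('v \<Rightarrow> 'a) \<Rightarrow> real" where
  "marg \<equiv> marginal V L"

definition fibre :: "'v set \<Rightarrow> ('v \<Rightarrow> 'a) \<Rightarrow> ('v \<Rightarrow> 'a) set" where
  "fibre A x = {y \<in> X. \<forall>v\<in>A. y v = x v}"

definition depends_on :: "'v set \<Rightarrow> (('v \<Rightarrow> 'a) \<Rightarrow> 'b) \<Rightarrow> bool" where
  "depends_on A f \<longleftrightarrow> (\<forall>x\<in>X. \<forall>y\<in>X. (\<forall>v\<in>A. x v = y v) \<longrightarrow> f x = f y)"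

lemma finite_V: "finite V"
  using state_space by (simp add: state_space_def)

lemma finite_L: "v \<in> V \<Longrightarrow> finite (L v)"
  using state_space by (simp add: state_space_def)

lemma card_L_pos: "v \<in> V \<Longrightarrow> 0 < card (L v)"
  using state_space by (force simp: state_space_def)

lemma finite_X: "finite X"
  unfolding configs_def by (intro finite_PiE finite_V finite_L)

lemma config_level: "x \<in> X \<Longrightarrow> v \<in> V \<Longrightarrow> x v \<in> L v"
  by (auto simp: configs_def PiE_iff)

lemma config_upd: "x \<in> X \<Longrightarrow> v \<in> V \<Longrightarrow> a \<in> L v \<Longrightarrow> x(v := a) \<in> X"
  by (auto simp: configs_def PiE_iff extensional_def)

lemma X_nonempty: "X \<noteq> {}"
  unfolding configs_def PiE_eq_empty_iff using card_L_pos by force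

lemma card_X_pos: "0 < card X"
  using finite_X X_nonempty by (simp add: card_gt_0_iff)

lemma finite_fibre: "finite (fibre A x)"
  using finite_X by (simp add: fibre_def)

lemma marg_fibre: "marg p A x = sum p (fibre A x)"
  by (simp add: marginal_def fibre_def)

lemma depends_onD:
  "depends_on A f \<Longrightarrow> x \<in> X \<Longrightarrow> y \<in> X \<Longrightarrow> (\<And>v. v \<in> A \<Longrightarrow> x v = y v) \<Longrightarrow> f x = f y"
  unfolding depends_on_def by blast

lemma depends_on_upd:
  assumes "depends_on A f" "v \<notin> A" "v \<in> V" "x \<in> X" "a \<in> L v"
  shows "f (x(v := a)) = f x"
proof -
  have "\<forall>u\<in>A. (x(v := a)) u = x u" using assms(2) by auto
  then show ?thesis
    using assms(1,4) config_upd[OF assms(4,3,5)] unfolding depends_on_def by blast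
qed

lemma depends_on_marg:
  assumes "A \<subseteq> B"
  shows "depends_on B (marg p A)"
proof -
  have "fibre A x = fibre A y" if "\<forall>v\<in>B. x v = y v" for x y
    using that assms unfolding fibre_def by (metis subsetD)
  then show ?thesis unfolding depends_on_def marg_fibre by metis
qed

lemma marg_empty: "marg p {} x = sum p X"
  by (simp add: marginal_def)

lemma marg_all: "x \<in> X \<Longrightarrow> marg p V x = p x"
proof -
  assume "x \<in> X"
  then have "fibre V x = {x}"
    by (auto simp: fibre_def configs_def intro: PiE_ext)
  then show ?thesis by (simp add: marg_fibre)
qed

lemma marg_pos:
  assumes "\<And>y. y \<in> X \<Longrightarrow> 0 < p y" and "x \<in> X"
  shows "0 < marg p A x"
  unfolding marg_fibre using assms finite_fibre[of A x]
  by (intro sum_pos) (auto simp: fibre_def)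

lemma marg_split:
  assumes "s \<in> V" and "s \<notin> A"
  shows "marg p A x = (\<Sum>a\<in>L s. marg p (insert s A) (x(s := a)))"
proof -
  have "fibre (insert s A) (x(s := a)) = {y \<in> fibre A x. y s = a}" for a
    using assms by (auto simp: fibre_def)
  then have "(\<Sum>a\<in>L s. marg p (insert s A) (x(s := a)))
      = (\<Sum>a\<in>L s. sum p {y \<in> fibre A x. y s = a})"
    by (simp add: marg_fibre)
  also have "\<dots> = sum p (fibre A x)"
    using assms by (intro sum.group finite_fibre finite_L) (auto simp: fibre_def config_level)
  finally show ?thesis by (simp add: marg_fibre)
qed

text \<open>
  Resampling coordinate \<open>s\<close> is measure preserving: \<open>(y, a) \<mapsto> (y(s := a), y s)\<close> is an involution
  of \<open>fibre A x \<times> L s\<close>. Hence a function whose average over the coordinate \<open>s\<close> is zero has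
  vanishing marginals on all sets that omit \<open>s\<close>.
\<close>

lemma marg_eq_0:
  assumes s: "s \<in> V" "s \<notin> A"
    and zero: "\<And>y. y \<in> X \<Longrightarrow> (\<Sum>a\<in>L s. f (y(s := a))) = 0"
  shows "marg f A x = 0"
proof -
  let ?S = "fibre A x \<times> L s"
  have "(\<Sum>(y, a)\<in>?S. f (y(s := a))) = (\<Sum>(y, a)\<in>?S. f y)"
    by (rule sum.reindex_bij_witness
        [where i = "\<lambda>(y, a). (y(s := a), y s)" and j = "\<lambda>(y, a). (y(s := a), y s)"])
      (use s in \<open>auto simp: fibre_def config_upd config_level\<close>)
  also have "\<dots> = card (L s) * marg f A x"
    by (simp add: sum.cartesian_product[symmetric] marg_fibre sum_distrib_left)
  finally have "card (L s) * marg f A x = (\<Sum>y\<in>fibre A x. \<Sum>a\<in>L s. f (y(s := a)))"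
    by (simp add: sum.cartesian_product[symmetric])
  also have "\<dots> = 0"
    by (rule sum.neutral) (auto simp: zero fibre_def)
  finally show ?thesis using card_L_pos[OF s(1)] by simp
qed

lemma sum_X_eq_0:
  fixes f :: "('v \<Rightarrow> 'a) \<Rightarrow> real"
  assumes "s \<in> V" and "\<And>y. y \<in> X \<Longrightarrow> (\<Sum>a\<in>L s. f (y(s := a))) = 0"
  shows "sum f X = 0"
  using marg_eq_0[of s "{}" f undefined] assms by (simp add: marg_empty)

definition fibre_size :: "'v set \<Rightarrow> real" where
  "fibre_size A = (\<Prod>v\<in>V. if v \<in> A then 1 else real (card (L v)))"

lemma card_fibre:
  assumes "x \<in> X"
  shows "real (card (fibre A x)) = fibre_size A"
proof -
  have "fibre A x = (\<Pi>\<^sub>E v\<in>V. if v \<in> A then {x v} else L v)"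
  proof (intro set_eqI iffI)
    fix y assume "y \<in> fibre A x"
    then show "y \<in> (\<Pi>\<^sub>E v\<in>V. if v \<in> A then {x v} else L v)"
      by (auto simp: fibre_def configs_def PiE_iff)
  next
    fix y assume y: "y \<in> (\<Pi>\<^sub>E v\<in>V. if v \<in> A then {x v} else L v)"
    have "y v \<in> L v" if "v \<in> V" for v
      using y config_level[OF assms that] that by (cases "v \<in> A") (auto simp: PiE_iff)
    moreover have "y v = x v" if "v \<in> A" for v
    proof (cases "v \<in> V")
      case True
      then show ?thesis using y that by (auto simp: PiE_iff)
    next
      case False
      then show ?thesis using y assms by (simp add: PiE_iff configs_def extensional_def)
    qed
    ultimately show "y \<in> fibre A x"
      using y by (auto simp: fibre_def configs_def PiE_iff)
  qed
  then have "card (fibre A x) = (\<Prod>v\<in>V. card (if v \<in> A then {x v} else L v))"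
    by (simp add: card_PiE finite_V)
  then show ?thesis
    unfolding fibre_size_def of_nat_prod by (auto intro!: prod.cong)
qed

lemma fibre_size_pos: "0 < fibre_size A"
  unfolding fibre_size_def by (intro prod_pos) (use card_L_pos in auto)

lemma fibre_size_modular:
  assumes "i \<noteq> j" "i \<notin> S" "j \<notin> S"
  shows "fibre_size (insert i (insert j S)) * fibre_size S
    = fibre_size (insert i S) * fibre_size (insert j S)"
  unfolding fibre_size_def prod.distrib[symmetric] using assms by (intro prod.cong) auto

lemma marg_of_dependent:
  assumes "depends_on A f" and "x \<in> X"
  shows "marg f A x = fibre_size A * f x"
proof -
  have "marg f A x = (\<Sum>y\<in>fibre A x. f x)"
    unfolding marg_fibre
    by (intro sum.cong refl depends_onD[OF assms(1)]) (use assms in \<open>auto simp: fibre_def\<close>)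
  then show ?thesis by (simp add: card_fibre[OF assms(2)])
qed

text \<open>
  Marginalisation is the orthogonal projection onto the functions of \<open>x\<^sub>A\<close>, up to the factor
  \<open>fibre_size A\<close>; in particular it is self-adjoint.
\<close>

lemma sum_mult_marg:
  assumes "depends_on A w"
  shows "(\<Sum>x\<in>X. w x * marg f A x) = fibre_size A * (\<Sum>x\<in>X. w x * f x)"
proof -
  have flip: "{x \<in> X. \<forall>v\<in>A. y v = x v} = fibre A y" for y
    by (auto simp: fibre_def)
  have "(\<Sum>x\<in>X. w x * marg f A x) = (\<Sum>x\<in>X. \<Sum>y | y \<in> X \<and> (\<forall>v\<in>A. y v = x v). w x * f y)"
    by (simp add: marginal_def sum_distrib_left)
  also have "\<dots> = (\<Sum>y\<in>X. \<Sum>x | x \<in> X \<and> (\<forall>v\<in>A. y v = x v). w x * f y)"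
    by (rule sum.swap_restrict[OF finite_X finite_X])
  also have "\<dots> = (\<Sum>y\<in>X. marg w A y * f y)"
    by (simp add: flip marg_fibre sum_distrib_right)
  also have "\<dots> = fibre_size A * (\<Sum>x\<in>X. w x * f x)"
    using assms by (simp add: marg_of_dependent sum_distrib_left mult.assoc)
  finally show ?thesis .
qed

section \<open>Factorisation along a directed acyclic graph\<close>

definition kernel_family ::
  "('v \<times> 'v) set \<Rightarrow> ('v \<Rightarrow> ('v \<Rightarrow> 'a) \<Rightarrow> real) \<Rightarrow> bool" where
  "kernel_family G q \<longleftrightarrow> (\<forall>v\<in>V. depends_on (insert v (parents G v)) (q v) \<and>
     (\<forall>x\<in>X. (\<Sum>a\<in>L v. q v (x(v := a))) = 1))"

lemma kernel_familyD:
  assumes "kernel_family G q" and "v \<in> V"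
  shows "depends_on (insert v (parents G v)) (q v)"
    and "x \<in> X \<Longrightarrow> (\<Sum>a\<in>L v. q v (x(v := a))) = 1"
  using assms by (auto simp: kernel_family_def)

lemma parents_subset: "dag V G \<Longrightarrow> parents G v \<subseteq> V"
  by (auto simp: dag_def parents_def)

lemma not_own_parent: "dag V G \<Longrightarrow> v \<notin> parents G v"
  by (auto simp: dag_def parents_def acyclic_def)

text \<open>
  The variables outside an ancestral set can be summed out one at a time, descendants first,
  and each of them contributes a kernel that sums to one. The induction runs in the opposite
  direction, enlarging the ancestral set by a source of its complement.
\<close>

lemma marg_ancestral:
  assumes G: "dag V G" and q: "kernel_family G q"
    and p: "\<And>x. x \<in> X \<Longrightarrow> p x = (\<Prod>v\<in>V. q v x)"
    and "A \<subseteq> V" and "\<And>u v. (u, v) \<in> G \<Longrightarrow> v \<in> A \<Longrightarrow> u \<in> A" and "x \<in> X"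
  shows "marg p A x = (\<Prod>v\<in>A. q v x)"
  using assms(4-6)
proof (induction "card (V - A)" arbitrary: A x)
  case 0
  then have "A = V" using finite_V by auto
  then show ?case using p 0 by (simp add: marg_all)
next
  case (Suc n)
  have "finite G" using G finite_V by (auto simp: dag_def intro: finite_subset)
  then have "wf G" using G by (simp add: dag_def finite_acyclic_wf)
  moreover obtain w where "w \<in> V - A"
    using Suc.hyps(2) by (metis card.empty equals0I nat.distinct(1))
  ultimately obtain s where s: "s \<in> V - A" and source: "\<And>u. (u, s) \<in> G \<Longrightarrow> u \<notin> V - A"
    by (rule wfE_min) blast
  have closed: "u \<in> insert s A" if "(u, v) \<in> G" "v \<in> insert s A" for u v
    using that Suc.prems(2) source G by (auto simp: dag_def)
  have IH: "marg p (insert s A) y = (\<Prod>v\<in>insert s A. q v y)" if "y \<in> X" for y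
  proof (rule Suc.hyps(1))
    show "n = card (V - insert s A)"
      using Suc.hyps(2) s finite_V by (simp add: card_Diff_insert)
  qed (use s closed that Suc.prems in auto)
  have finA: "finite A" using Suc.prems(1) finite_V by (rule finite_subset)
  have "marg p A x = (\<Sum>a\<in>L s. marg p (insert s A) (x(s := a)))"
    using s by (intro marg_split) auto
  also have "\<dots> = (\<Sum>a\<in>L s. q s (x(s := a)) * (\<Prod>v\<in>A. q v x))"
  proof (intro sum.cong refl)
    fix a assume a: "a \<in> L s"
    have "q v (x(s := a)) = q v x" if "v \<in> A" for v
      by (rule depends_on_upd[OF kernel_familyD(1)[OF q]])
        (use that s a Suc.prems in \<open>auto simp: parents_def\<close>)
    then show "marg p (insert s A) (x(s := a)) = q s (x(s := a)) * (\<Prod>v\<in>A. q v x)"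
      using s a Suc.prems finA by (subst IH) (auto simp: config_upd)
  qed
  also have "\<dots> = (\<Prod>v\<in>A. q v x)"
    using s kernel_familyD(2)[OF q] Suc.prems by (simp add: sum_distrib_right[symmetric])
  finally show ?case .
qed

text \<open>
  This contains the local Markov property: given its parents, \<open>v\<close> is independent of its other
  non-descendants. For \<open>B\<close> the set of all non-descendants, \<open>B\<close> and \<open>insert v B\<close> are
  both ancestral and the products differ by the factor \<open>q v\<close>; since \<open>q v\<close> does not involve the
  remaining non-descendants, these can be summed out on both sides.
\<close>

lemma marg_insert_nondescendants:
  assumes G: "dag V G" and q: "kernel_family G q"
    and p: "\<And>x. x \<in> X \<Longrightarrow> p x = (\<Prod>v\<in>V. q v x)"
    and v: "v \<in> V" and "parents G v \<subseteq> B" and "B \<subseteq> V" and "v \<notin> B"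
    and "\<And>u. u \<in> B \<Longrightarrow> (v, u) \<notin> G\<^sup>+" and "x \<in> X"
  shows "marg p (insert v B) x = q v x * marg p B x"
proof -
  define N where "N = {u \<in> V. u \<noteq> v \<and> (v, u) \<notin> G\<^sup>+}"
  have finN: "finite N" using finite_V by (simp add: N_def)
  have vN: "v \<notin> N" by (simp add: N_def)
  have GV: "G \<subseteq> V \<times> V" and acy: "acyclic G" using G by (auto simp: dag_def)
  have N_closed: "u \<in> N" if "(u, w) \<in> G" "w \<in> N" for u w
    using that GV by (auto simp: N_def dest: trancl_into_trancl)
  have pa_N: "u \<in> N" if "(u, v) \<in> G" for u
    using that GV acy by (auto simp: N_def acyclic_def dest: trancl_into_trancl)
  have "B \<subseteq> N" using assms by (auto simp: N_def)
  then show ?thesis using \<open>parents G v \<subseteq> B\<close> \<open>x \<in> X\<close>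
  proof (induction "card (N - B)" arbitrary: B x)
    case 0
    then have B: "B = N" using finN by auto
    have "marg p (insert v N) x = (\<Prod>u\<in>insert v N. q u x)"
      by (rule marg_ancestral[OF G q p])
        (use v N_closed pa_N 0 in \<open>auto simp: N_def\<close>)
    moreover have "marg p N x = (\<Prod>u\<in>N. q u x)"
      by (rule marg_ancestral[OF G q p]) (use N_closed 0 in \<open>auto simp: N_def\<close>)
    ultimately show ?case using finN vN B by simp
  next
    case (Suc n)
    then obtain s where s: "s \<in> N - B"
      by (metis all_not_in_conv card.empty nat.distinct(1))
    then have sV: "s \<in> V" and sv: "s \<noteq> v" by (auto simp: N_def)
    have "marg p (insert v B) x = (\<Sum>a\<in>L s. marg p (insert v (insert s B)) (x(s := a)))"
      using s sV sv by (subst marg_split[of s]) (auto simp: insert_commute)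
    also have "\<dots> = (\<Sum>a\<in>L s. q v x * marg p (insert s B) (x(s := a)))"
    proof (intro sum.cong refl)
      fix a assume a: "a \<in> L s"
      have "marg p (insert v (insert s B)) (x(s := a))
          = q v (x(s := a)) * marg p (insert s B) (x(s := a))"
      proof (rule Suc.hyps(1))
        show "n = card (N - insert s B)"
          using Suc.hyps(2) s finN by (simp add: card_Diff_insert)
      qed (use s a sV Suc.prems in \<open>auto simp: config_upd\<close>)
      moreover have "q v (x(s := a)) = q v x"
        by (rule depends_on_upd[OF kernel_familyD(1)[OF q v]])
          (use s sv sV a Suc.prems in auto)
      ultimately show "marg p (insert v (insert s B)) (x(s := a))
          = q v x * marg p (insert s B) (x(s := a))"
        by simp
    qed
    also have "\<dots> = q v x * marg p B x"
      using s sV by (simp add: marg_split[of s B] sum_distrib_left)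
    finally show ?case .
  qed
qed

lemma bn_modelI:
  assumes G: "dag V G" and q: "kernel_family G q"
    and pos: "\<And>v x. v \<in> V \<Longrightarrow> x \<in> X \<Longrightarrow> 0 < q v x"
  shows "(\<lambda>x. if x \<in> X then \<Prod>v\<in>V. q v x else 0) \<in> bn_model V L G" (is "?p \<in> _")
proof -
  have p_pos: "0 < ?p x" if "x \<in> X" for x
    using that pos by (auto intro: prod_pos)
  obtain z where "z \<in> X" using X_nonempty by blast
  then have "sum ?p X = 1"
    using marg_ancestral[OF G q, of ?p "{}" z] by (simp add: marg_empty)
  then have simplex: "?p \<in> open_simplex X"
    using p_pos by (simp add: open_simplex_def)
  have "conditional V L ?p {v} (parents G v) x = q v x" if "v \<in> V" "x \<in> X" for v x
  proof -
    have acy: "(v, u) \<notin> G\<^sup>+" if "u \<in> parents G v" for u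
      using that G by (auto simp: parents_def dag_def acyclic_def dest: trancl_into_trancl)
    have "marg ?p (insert v (parents G v)) x = q v x * marg ?p (parents G v) x"
      by (rule marg_insert_nondescendants[OF G q])
        (use that acy parents_subset[OF G] not_own_parent[OF G] in auto)
    moreover have "0 < marg ?p (parents G v) x"
      by (rule marg_pos) (use p_pos that in auto)
    ultimately show ?thesis by (simp add: conditional_def)
  qed
  then show ?thesis using simplex by (simp add: bn_model_def)
qed

lemma bn_model_kernels:
  assumes G: "dag V G" and p: "p \<in> bn_model V L G"
  shows "kernel_family G (\<lambda>v. conditional V L p {v} (parents G v))"
  unfolding kernel_family_def
proof (intro ballI conjI)
  fix v assume v: "v \<in> V"
  let ?P = "parents G v"
  show "depends_on (insert v ?P) (conditional V L p {v} ?P)"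
  proof -
    have "depends_on (insert v ?P) (marg p (insert v ?P))"
      and "depends_on (insert v ?P) (marg p ?P)"
      by (rule depends_on_marg, blast)+
    then show ?thesis
      unfolding depends_on_def conditional_def insert_is_Un[symmetric] by metis
  qed
  fix x assume x: "x \<in> X"
  have vP: "v \<notin> ?P" by (rule not_own_parent[OF G])
  have "marg p ?P (x(v := a)) = marg p ?P x" if "a \<in> L v" for a
    by (rule depends_on_upd[OF depends_on_marg[OF order_refl] vP v x that])
  then have "(\<Sum>a\<in>L v. conditional V L p {v} ?P (x(v := a)))
      = (\<Sum>a\<in>L v. marg p (insert v ?P) (x(v := a))) / marg p ?P x"
    by (simp add: conditional_def sum_divide_distrib)
  also have "\<dots> = marg p ?P x / marg p ?P x"
    using marg_split[OF v vP] by simp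
  also have "\<dots> = 1"
  proof -
    have "0 < marg p ?P x"
      by (rule marg_pos) (use p x in \<open>auto simp: bn_model_def open_simplex_def\<close>)
    then show ?thesis by simp
  qed
  finally show "(\<Sum>a\<in>L v. conditional V L p {v} ?P (x(v := a))) = 1" .
qed

definition cond_indep :: "(('v \<Rightarrow> 'a) \<Rightarrow> real) \<Rightarrow> 'v \<Rightarrow> 'v \<Rightarrow> 'v set \<Rightarrow> bool" where
  "cond_indep p i j S \<longleftrightarrow> (\<forall>x\<in>X. marg p (insert i (insert j S)) x * marg p S x
     = marg p (insert i S) x * marg p (insert j S) x)"

lemma cond_indep_sym: "cond_indep p i j S \<longleftrightarrow> cond_indep p j i S"
  by (simp add: cond_indep_def insert_commute mult.commute)

lemma bn_model_cond_indep:
  assumes G: "dag V G" and p: "p \<in> bn_model V L G"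
    and ij: "i \<in> V" "j \<in> V" "i \<noteq> j" "(i, j) \<notin> G" "(j, i) \<notin> G\<^sup>+"
  shows "cond_indep p i j (parents G j)"
  unfolding cond_indep_def
proof
  fix x assume x: "x \<in> X"
  let ?P = "parents G j" and ?q = "\<lambda>v. conditional V L p {v} (parents G v)"
  have p_prod: "p x = (\<Prod>v\<in>V. ?q v x)" if "x \<in> X" for x
    using p that by (simp add: bn_model_def)
  have acy: "(j, u) \<notin> G\<^sup>+" if "u \<in> ?P" for u
    using that G by (auto simp: parents_def dag_def acyclic_def dest: trancl_into_trancl)
  note markov = marg_insert_nondescendants[OF G bn_model_kernels[OF G p] p_prod ij(2)]
  have "marg p (insert j (insert i ?P)) x = ?q j x * marg p (insert i ?P) x"
    by (rule markov) (use ij x acy parents_subset[OF G] not_own_parent[OF G] in auto)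
  moreover have "marg p (insert j ?P) x = ?q j x * marg p ?P x"
    by (rule markov) (use ij x acy parents_subset[OF G] not_own_parent[OF G] in auto)
  ultimately show "marg p (insert i (insert j ?P)) x * marg p ?P x
      = marg p (insert i ?P) x * marg p (insert j ?P) x"
    by (simp add: insert_commute)
qed

section \<open>Tangent directions at the uniform distribution\<close>

definition uniform :: "('v \<Rightarrow> 'a) \<Rightarrow> real" where
  "uniform x = (if x \<in> X then 1 / card X else 0)"

lemma uniform_conv_prod:
  assumes "x \<in> X"
  shows "uniform x = (\<Prod>v\<in>V. 1 / card (L v))"
  using assms by (simp add: uniform_def configs_def card_PiE finite_V prod_dividef)

lemma uniform_pos: "x \<in> X \<Longrightarrow> 0 < uniform x"
  using card_X_pos by (simp add: uniform_def)

lemma depends_on_uniform: "depends_on A uniform"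
  by (simp add: depends_on_def uniform_def)

lemma tendsto_fun_iff:
  fixes f :: "'b \<Rightarrow> 'c \<Rightarrow> real"
  shows "(f \<longlongrightarrow> l) F \<longleftrightarrow> (\<forall>x. ((\<lambda>n. f n x) \<longlongrightarrow> l x) F)"
  using limitin_componentwise[of "\<lambda>_::'c. euclidean :: real topology" UNIV f l F]
  by (simp add: euclidean_product_topology)

text \<open>
  Perturbing each uniform kernel by a mean-zero function \<open>c v\<close> of \<open>v\<close> and its parents stays
  inside the model, and by the product rule the resulting curve has velocity
  \<open>uniform x * (\<Sum>v\<in>V. c v x)\<close>.
\<close>

lemma tangent_at_uniform:
  assumes G: "dag V G"
    and dep: "\<And>v. v \<in> V \<Longrightarrow> depends_on (insert v (parents G v)) (c v)"
    and mean: "\<And>v x. v \<in> V \<Longrightarrow> x \<in> X \<Longrightarrow> (\<Sum>a\<in>L v. c v (x(v := a))) = 0"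
  shows "(\<lambda>x. uniform x * (\<Sum>v\<in>V. c v x)) \<in> tangent_cone (bn_model V L G) uniform"
    and "uniform \<in> bn_model V L G"
proof -
  \<comment> \<open>A bound on all perturbations: the kernels remain positive for step sizes below \<open>1 / B\<close>.\<close>
  define B where "B = (\<Sum>v\<in>V. \<Sum>x\<in>X. \<bar>c v x\<bar>)"
  define path where "path e x = uniform x * (\<Prod>v\<in>V. 1 + e * c v x)" for e :: real and x
  have B: "\<bar>c v x\<bar> \<le> B" if "v \<in> V" "x \<in> X" for v x
  proof -
    have "\<bar>c v x\<bar> \<le> (\<Sum>x\<in>X. \<bar>c v x\<bar>)"
      by (rule member_le_sum) (use that finite_X in auto)
    also have "\<dots> \<le> B" unfolding B_def
      by (rule member_le_sum) (use that finite_V in \<open>auto intro: sum_nonneg\<close>)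
    finally show ?thesis .
  qed
  have B0: "0 \<le> B" by (auto simp: B_def intro: sum_nonneg)
  have path_mem: "path e \<in> bn_model V L G" if e: "0 \<le> e" "e * B < 1" for e
  proof -
    define q where "q v x = (1 + e * c v x) / card (L v)" for v x
    have "kernel_family G q"
      unfolding kernel_family_def
    proof (intro ballI conjI)
      fix v assume v: "v \<in> V"
      show "depends_on (insert v (parents G v)) (q v)"
        using dep[OF v] unfolding depends_on_def q_def by metis
      show "(\<Sum>a\<in>L v. q v (x(v := a))) = 1" if "x \<in> X" for x
        using mean[OF v that] card_L_pos[OF v] unfolding q_def
        by (simp add: sum_divide_distrib[symmetric] sum.distrib sum_distrib_left[symmetric])
    qed
    moreover have "0 < q v x" if "v \<in> V" "x \<in> X" for v x
    proof -
      have "e * \<bar>c v x\<bar> \<le> e * B" using B[OF that] e by (intro mult_left_mono) auto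
      then have "\<bar>e * c v x\<bar> < 1" using e by (simp add: abs_mult)
      then show ?thesis using card_L_pos[OF that(1)] by (simp add: q_def)
    qed
    ultimately have "(\<lambda>x. if x \<in> X then \<Prod>v\<in>V. q v x else 0) \<in> bn_model V L G"
      by (rule bn_modelI[OF G])
    also have "(\<lambda>x. if x \<in> X then \<Prod>v\<in>V. q v x else 0) = path e"
    proof
      show "(if x \<in> X then \<Prod>v\<in>V. q v x else 0) = path e x" for x
        by (cases "x \<in> X")
          (simp_all add: path_def q_def prod_dividef uniform_conv_prod, simp add: uniform_def)
    qed
    finally show ?thesis .
  qed
  have path_0: "path 0 = uniform" by (simp add: path_def fun_eq_iff)
  then show "uniform \<in> bn_model V L G" using path_mem[of 0] by simp
  define \<alpha> where "\<alpha> n = real n + 1 + B" for n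
  have \<alpha>_pos: "0 < \<alpha> n" for n using B0 by (simp add: \<alpha>_def)
  have "filterlim \<alpha> at_top sequentially"
    unfolding \<alpha>_def add.assoc
    by (rule filterlim_tendsto_add_at_top[OF tendsto_const filterlim_real_sequentially,
        of "1 + B", simplified add.commute[of "1 + B"]])
  then have step: "filterlim (\<lambda>n. 1 / \<alpha> n) (at 0) sequentially"
    unfolding filterlim_at using \<alpha>_pos
    by (auto intro!: tendsto_divide_0[OF tendsto_const] filterlim_at_top_imp_at_infinity
        eventuallyI simp: less_imp_neq[symmetric])
  have deriv: "((\<lambda>e. path e x) has_field_derivative uniform x * (\<Sum>v\<in>V. c v x)) (at 0)" for x
  proof -
    have "((\<lambda>e. \<Prod>v\<in>V. 1 + e * c v x) has_field_derivative
        (\<Sum>v\<in>V. c v x * (\<Prod>u\<in>V - {v}. 1 + 0 * c u x))) (at 0)"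
      by (rule has_field_derivative_prod) (auto intro!: derivative_eq_intros)
    from DERIV_cmult[OF this, of "uniform x"] show ?thesis
      by (simp add: path_def)
  qed
  show "(\<lambda>x. uniform x * (\<Sum>v\<in>V. c v x)) \<in> tangent_cone (bn_model V L G) uniform"
    unfolding tangent_cone_def
  proof (intro CollectI exI conjI allI)
    show "0 < \<alpha> n" for n by (rule \<alpha>_pos)
    show "path (1 / \<alpha> n) \<in> bn_model V L G" for n
      by (rule path_mem) (use \<alpha>_pos[of n] B0 in \<open>auto simp: \<alpha>_def divide_simps\<close>)
    show "(\<lambda>n. path (1 / \<alpha> n)) \<longlonglongrightarrow> uniform"
      unfolding tendsto_fun_iff
    proof
      fix x
      have "isCont (\<lambda>e. path e x) 0" using deriv by (rule DERIV_isCont)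
      then have "((\<lambda>e. path e x) \<longlongrightarrow> uniform x) (at 0)"
        using path_0 by (simp add: isCont_def)
      then show "(\<lambda>n. path (1 / \<alpha> n) x) \<longlonglongrightarrow> uniform x"
        using step by (rule filterlim_compose)
    qed
    show "(\<lambda>n x. \<alpha> n * (path (1 / \<alpha> n) x - uniform x))
        \<longlonglongrightarrow> (\<lambda>x. uniform x * (\<Sum>v\<in>V. c v x))"
      unfolding tendsto_fun_iff
    proof
      fix x
      have "((\<lambda>e. (path e x - uniform x) / e) \<longlongrightarrow> uniform x * (\<Sum>v\<in>V. c v x)) (at 0)"
        using deriv[of x] path_0 by (simp add: DERIV_def)
      from filterlim_compose[OF this step]
      show "(\<lambda>n. \<alpha> n * (path (1 / \<alpha> n) x - uniform x)) \<longlonglongrightarrow> uniform x * (\<Sum>v\<in>V. c v x)"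
        by (simp add: mult.commute)
    qed
  qed
qed

text \<open>
  The direction that separates the tangent cones: an interaction of \<open>i\<close> with \<open>k\<close> plus an
  interaction of \<open>j\<close> with \<open>k\<close>.
\<close>

definition edge_pair ::
  "'v \<Rightarrow> 'v \<Rightarrow> 'v \<Rightarrow> ('a \<Rightarrow> real) \<Rightarrow> ('a \<Rightarrow> real) \<Rightarrow> ('a \<Rightarrow> real) \<Rightarrow> ('v \<Rightarrow> 'a) \<Rightarrow> real" where
  "edge_pair i j k f g s x = uniform x * (f (x i) * s (x k)) + uniform x * (g (x j) * s (x k))"

text \<open>
  Each interaction is carried by the kernel at the head of its edge, whichever way the edge
  points. So the direction is tangent to the model whether or not \<open>k\<close> is a collider.
\<close>

lemma edge_pair_tangent:
  assumes G: "dag V G" and V: "i \<in> V" "j \<in> V" "k \<in> V" and ne: "i \<noteq> k" "j \<noteq> k"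
    and adj: "adjacent G i k" "adjacent G j k"
    and mean: "sum f (L i) = 0" "sum g (L j) = 0" "sum s (L k) = 0"
  shows "edge_pair i j k f g s \<in> tangent_cone (bn_model V L G) uniform"
    and "uniform \<in> bn_model V L G"
proof -
  define b where "b = (if (i, k) \<in> G then k else i)"
  define d where "d = (if (j, k) \<in> G then k else j)"
  define c where "c v x = (if v = b then f (x i) * s (x k) else 0)
      + (if v = d then g (x j) * s (x k) else 0)" for v and x :: "'v \<Rightarrow> 'a"
  have bd: "b \<in> V" "d \<in> V" using V by (auto simp: b_def d_def)
  have b_edge: "i \<in> insert b (parents G b)" "k \<in> insert b (parents G b)"
    and d_edge: "j \<in> insert d (parents G d)" "k \<in> insert d (parents G d)"
    using adj by (auto simp: b_def d_def adjacent_def parents_def)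
  have dep: "depends_on (insert v (parents G v)) (c v)" if "v \<in> V" for v
    unfolding depends_on_def
  proof (intro ballI impI)
    fix x y :: "'v \<Rightarrow> 'a" assume eq: "\<forall>u\<in>insert v (parents G v). x u = y u"
    have "x i = y i \<and> x k = y k" if "v = b" using b_edge eq that by blast
    moreover have "x j = y j \<and> x k = y k" if "v = d" using d_edge eq that by blast
    ultimately show "c v x = c v y" by (auto simp: c_def)
  qed
  have mean_c: "(\<Sum>a\<in>L v. c v (x(v := a))) = 0" if "v \<in> V" for v x
  proof -
    have "(\<Sum>a\<in>L b. f ((x(b := a)) i) * s ((x(b := a)) k)) = 0"
      using ne mean by (auto simp: b_def sum_distrib_left[symmetric] sum_distrib_right[symmetric])
    moreover have "(\<Sum>a\<in>L d. g ((x(d := a)) j) * s ((x(d := a)) k)) = 0"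
      using ne mean by (auto simp: d_def sum_distrib_left[symmetric] sum_distrib_right[symmetric])
    ultimately show ?thesis
      unfolding c_def sum.distrib
      by (cases "v = b"; cases "v = d") (simp_all del: fun_upd_apply)
  qed
  have "(\<lambda>x. uniform x * (\<Sum>v\<in>V. c v x)) = edge_pair i j k f g s"
    using bd finite_V by (simp add: fun_eq_iff c_def sum.distrib edge_pair_def distrib_left)
  then show "edge_pair i j k f g s \<in> tangent_cone (bn_model V L G) uniform"
    and "uniform \<in> bn_model V L G"
    using tangent_at_uniform[OF G, of c] dep mean_c by auto
qed

section \<open>Second-order consequences of conditional independence\<close>

text \<open>
  The deviation from \<open>i \<bottom> j | S\<close>, as a quadratic form in a perturbation \<open>r\<close> of the uniform
  distribution, tested against a contrast \<open>w\<close> in \<open>x\<^sub>i\<close> and \<open>x\<^sub>j\<close>.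
\<close>

definition defect ::
  "(('v \<Rightarrow> 'a) \<Rightarrow> real) \<Rightarrow> 'v \<Rightarrow> 'v \<Rightarrow> 'v set \<Rightarrow> (('v \<Rightarrow> 'a) \<Rightarrow> real) \<Rightarrow> real" where
  "defect w i j S r = (\<Sum>x\<in>X. w x * (marg r (insert i S) x * marg r (insert j S) x
     - marg r (insert i (insert j S)) x * marg r S x))"

lemma marg_affine:
  assumes "x \<in> X" and "\<alpha> \<noteq> 0"
  shows "marg p A x = fibre_size A / card X + marg (\<lambda>y. \<alpha> * (p y - uniform y)) A x / \<alpha>"
proof -
  have "marg (\<lambda>y. \<alpha> * (p y - uniform y)) A x = \<alpha> * (marg p A x - marg uniform A x)"
    by (simp add: marg_fibre sum_distrib_left[symmetric] sum_subtractf)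
  moreover have "marg uniform A x = fibre_size A / card X"
    using assms(1) by (simp add: marg_of_dependent[OF depends_on_uniform]) (simp add: uniform_def)
  ultimately show ?thesis using assms(2) by simp
qed

text \<open>
  Write \<open>p = uniform + r / \<alpha>\<close> in the equation \<open>p\<^sub>i\<^sub>j\<^sub>S * p\<^sub>S = p\<^sub>i\<^sub>S * p\<^sub>j\<^sub>S\<close>. The constant terms cancel;
  of the terms linear in \<open>r\<close> only \<open>r\<^sub>i\<^sub>j\<^sub>S\<close> survives the test against \<open>w\<close>, because each of the other
  marginals is constant in \<open>x\<^sub>i\<close> or in \<open>x\<^sub>j\<close>. So the \<open>w\<close>-component of \<open>r\<close> is of order \<open>1 / \<alpha>\<close>,
  with a coefficient determined by \<open>S\<close>.
\<close>

lemma cond_indep_second_order: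
  assumes ij: "i \<in> V" "j \<in> V" "i \<noteq> j" "i \<notin> S" "j \<notin> S"
    and w: "depends_on {i, j} w"
    and w_i: "\<And>x. x \<in> X \<Longrightarrow> (\<Sum>a\<in>L i. w (x(i := a))) = 0"
    and w_j: "\<And>x. x \<in> X \<Longrightarrow> (\<Sum>a\<in>L j. w (x(j := a))) = 0"
    and \<alpha>: "\<alpha> \<noteq> 0" and ci: "cond_indep p i j S"
    and r_def: "r = (\<lambda>x. \<alpha> * (p x - uniform x))"
  shows "\<alpha> * (\<Sum>x\<in>X. w x * r x)
    = defect w i j S r * (card X / (fibre_size S * fibre_size (insert i (insert j S))))"
proof -
  let ?iS = "insert i S" and ?jS = "insert j S" and ?ijS = "insert i (insert j S)"
  let ?n = fibre_size and ?N = "real (card X)"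
  have N: "?N \<noteq> 0" using card_X_pos by simp
  have kill_i: "(\<Sum>x\<in>X. w x * marg r A x) = 0" if "i \<notin> A" for A
  proof (rule sum_X_eq_0[OF ij(1)])
    fix x assume x: "x \<in> X"
    have "marg r A (x(i := a)) = marg r A x" if "a \<in> L i" for a
      by (rule depends_on_upd[OF depends_on_marg[OF order_refl] \<open>i \<notin> A\<close> ij(1) x that])
    then show "(\<Sum>a\<in>L i. w (x(i := a)) * marg r A (x(i := a))) = 0"
      using w_i[OF x] by (simp add: sum_distrib_right[symmetric])
  qed
  have kill_j: "(\<Sum>x\<in>X. w x * marg r A x) = 0" if "j \<notin> A" for A
  proof (rule sum_X_eq_0[OF ij(2)])
    fix x assume x: "x \<in> X"
    have "marg r A (x(j := a)) = marg r A x" if "a \<in> L j" for a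
      by (rule depends_on_upd[OF depends_on_marg[OF order_refl] \<open>j \<notin> A\<close> ij(2) x that])
    then show "(\<Sum>a\<in>L j. w (x(j := a)) * marg r A (x(j := a))) = 0"
      using w_j[OF x] by (simp add: sum_distrib_right[symmetric])
  qed
  have pointwise: "marg r ?iS x * marg r ?jS x - marg r ?ijS x * marg r S x
      = \<alpha> / ?N * (?n ?ijS * marg r S x + ?n S * marg r ?ijS x
          - ?n ?iS * marg r ?jS x - ?n ?jS * marg r ?iS x)" if x: "x \<in> X" for x
  proof -
    have affine: "marg p A x = ?n A / ?N + marg r A x / \<alpha>" for A
      unfolding r_def by (rule marg_affine[OF x \<alpha>])
    have "(?n ?ijS / ?N + marg r ?ijS x / \<alpha>) * (?n S / ?N + marg r S x / \<alpha>)
        = (?n ?iS / ?N + marg r ?iS x / \<alpha>) * (?n ?jS / ?N + marg r ?jS x / \<alpha>)"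
      using ci[unfolded cond_indep_def, rule_format, OF x] unfolding affine .
    moreover have "?n ?ijS * ?n S = ?n ?iS * ?n ?jS"
      by (rule fibre_size_modular[OF ij(3-5)])
    \<comment> \<open>The field identity that remains, stated for arbitrary reals to keep the terms small.\<close>
    moreover have "u = v" if "(nij / N + rij / a) * (ns / N + rs / a)
          = (ni / N + ri / a) * (nj / N + rj / a)" "nij * ns = ni * nj" "a \<noteq> 0" "N \<noteq> 0"
        "u = ri * rj - rij * rs" "v = a / N * (nij * rs + ns * rij - ni * rj - nj * ri)"
      for nij ns ni nj rij rs ri rj a N u v :: real
    proof -
      have "(nij * a + rij * N) * (ns * a + rs * N) = (ni * a + ri * N) * (nj * a + rj * N)"
        using that(1,3,4) by (simp add: field_simps)
      then have "a * N * (nij * rs + ns * rij - ni * rj - nj * ri)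
          = N * N * (ri * rj - rij * rs)"
        using that(2) by algebra
      moreover have "N * v = a * (nij * rs + ns * rij - ni * rj - nj * ri)"
        using that(4,6) by simp
      ultimately have "N * N * u = N * N * v" using that(5) by algebra
      then show ?thesis using that(4) by simp
    qed
    ultimately show ?thesis using \<alpha> N by blast
  qed
  have "defect w i j S r = (\<Sum>x\<in>X. w x * (\<alpha> / ?N * (?n ?ijS * marg r S x
      + ?n S * marg r ?ijS x - ?n ?iS * marg r ?jS x - ?n ?jS * marg r ?iS x)))"
    unfolding defect_def by (intro sum.cong refl) (simp only: pointwise)
  also have "\<dots> = \<alpha> / ?N * (?n ?ijS * (\<Sum>x\<in>X. w x * marg r S x)
      + ?n S * (\<Sum>x\<in>X. w x * marg r ?ijS x) - ?n ?iS * (\<Sum>x\<in>X. w x * marg r ?jS x)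
      - ?n ?jS * (\<Sum>x\<in>X. w x * marg r ?iS x))"
    by (simp add: sum_distrib_left sum.distrib sum_subtractf algebra_simps)
  also have "\<dots> = \<alpha> / ?N * (?n S * (\<Sum>x\<in>X. w x * marg r ?ijS x))"
    using kill_i[of S] kill_i[of ?jS] kill_j[of ?iS] ij by simp
  also have "(\<Sum>x\<in>X. w x * marg r ?ijS x) = ?n ?ijS * (\<Sum>x\<in>X. w x * r x)"
  proof (rule sum_mult_marg)
    show "depends_on ?ijS w" using w unfolding depends_on_def by blast
  qed
  finally show ?thesis
    using N fibre_size_pos[of S] fibre_size_pos[of ?ijS] by (simp add: field_simps)
qed

lemma cond_indep_limit:
  assumes ij: "i \<in> V" "j \<in> V" "i \<noteq> j" "i \<notin> S" "j \<notin> S"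
    and w: "depends_on {i, j} w"
    and w_i: "\<And>x. x \<in> X \<Longrightarrow> (\<Sum>a\<in>L i. w (x(i := a))) = 0"
    and w_j: "\<And>x. x \<in> X \<Longrightarrow> (\<Sum>a\<in>L j. w (x(j := a))) = 0"
    and \<alpha>: "\<And>n :: nat. 0 < \<alpha> n" and ci: "\<And>n. cond_indep (t n) i j S"
    and lim: "(\<lambda>n x. \<alpha> n * (t n x - uniform x)) \<longlonglongrightarrow> h"
  shows "(\<lambda>n. \<alpha> n * (\<Sum>x\<in>X. w x * (\<alpha> n * (t n x - uniform x))))
    \<longlonglongrightarrow> defect w i j S h * (card X / (fibre_size S * fibre_size (insert i (insert j S))))"
proof -
  have "(\<lambda>n. marg (\<lambda>x. \<alpha> n * (t n x - uniform x)) A y) \<longlonglongrightarrow> marg h A y" for A y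
    unfolding marg_fibre using lim by (intro tendsto_sum) (simp add: tendsto_fun_iff)
  then have "(\<lambda>n. defect w i j S (\<lambda>x. \<alpha> n * (t n x - uniform x))) \<longlonglongrightarrow> defect w i j S h"
    unfolding defect_def by (intro tendsto_intros)
  moreover have "\<alpha> n * (\<Sum>x\<in>X. w x * (\<alpha> n * (t n x - uniform x)))
      = defect w i j S (\<lambda>x. \<alpha> n * (t n x - uniform x))
        * (card X / (fibre_size S * fibre_size (insert i (insert j S))))" for n
    by (rule cond_indep_second_order[OF ij w w_i w_j _ ci refl]) (use \<alpha>[of n] in auto)
  ultimately show ?thesis by (simp only: tendsto_mult_right)
qed

text \<open>
  Two independences \<open>i \<bottom> j | C\<close> and \<open>i \<bottom> j | D\<close> must predict the same second-order
  \<open>w\<close>-component, so a common tangent direction has proportional defects for \<open>C\<close> and \<open>D\<close>. For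
  \<open>edge_pair\<close> all marginals without \<open>k\<close> vanish, hence so does the defect for \<open>C\<close>; when \<open>D\<close>
  contains \<open>k\<close>, the defect is a positive multiple of the sum of the squares of
  \<open>f (x i) * g (x j) * s (x k)\<close>.
\<close>

lemma edge_pair_not_tangent:
  assumes V: "i \<in> V" "j \<in> V" "k \<in> V" and ne: "i \<noteq> j" "i \<noteq> k" "j \<noteq> k"
    and C: "i \<notin> C" "j \<notin> C" "k \<notin> C" and D: "i \<notin> D" "j \<notin> D" "k \<in> D"
    and ciC: "\<And>p. p \<in> M \<Longrightarrow> cond_indep p i j C"
    and ciD: "\<And>p. p \<in> M \<Longrightarrow> cond_indep p i j D"
    and mean: "sum f (L i) = 0" "sum g (L j) = 0" "sum s (L k) = 0"
    and nonzero: "\<exists>a\<in>L i. f a \<noteq> 0" "\<exists>a\<in>L j. g a \<noteq> 0" "\<exists>a\<in>L k. s a \<noteq> 0"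
  shows "edge_pair i j k f g s \<notin> tangent_cone M uniform"
proof
  let ?h = "edge_pair i j k f g s"
  assume "?h \<in> tangent_cone M uniform"
  then obtain \<alpha> t where \<alpha>: "\<And>n. 0 < \<alpha> n" and t: "\<And>n. t n \<in> M"
    and lim: "(\<lambda>n x. \<alpha> n * (t n x - uniform x)) \<longlonglongrightarrow> ?h"
    unfolding tangent_cone_def by blast
  define w where "w x = f (x i) * g (x j)" for x :: "'v \<Rightarrow> 'a"
  have w: "depends_on {i, j} w" by (simp add: depends_on_def w_def)
  have w_i: "(\<Sum>a\<in>L i. w (x(i := a))) = 0" for x
    using ne mean by (simp add: w_def sum_distrib_right[symmetric])
  have w_j: "(\<Sum>a\<in>L j. w (x(j := a))) = 0" for x
    using ne mean by (simp add: w_def sum_distrib_left[symmetric])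
  note limit = cond_indep_limit[OF V(1,2) ne(1) _ _ w w_i w_j \<alpha> _ lim]
  have "defect w i j C ?h * (card X / (fibre_size C * fibre_size (insert i (insert j C))))
      = defect w i j D ?h * (card X / (fibre_size D * fibre_size (insert i (insert j D))))"
    by (rule LIMSEQ_unique[OF limit limit]) (use C D ciC ciD t in auto)
  moreover have "defect w i j C ?h = 0"
  proof -
    have "marg ?h A x = 0" if "k \<notin> A" for A x
    proof (rule marg_eq_0[OF V(3) that])
      fix y assume "y \<in> X"
      then have u: "uniform (y(k := a)) = uniform y" if "a \<in> L k" for a
        using that V by (simp add: uniform_def config_upd)
      have "(\<Sum>a\<in>L k. ?h (y(k := a))) = (\<Sum>a\<in>L k. (uniform y * (f (y i) + g (y j))) * s a)"
        using ne by (intro sum.cong) (auto simp: edge_pair_def u algebra_simps)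
      also have "\<dots> = 0" using mean by (simp add: sum_distrib_left[symmetric])
      finally show "(\<Sum>a\<in>L k. ?h (y(k := a))) = 0" .
    qed
    then show ?thesis using C ne by (simp add: defect_def)
  qed
  moreover have "0 < defect w i j D ?h"
  proof -
    let ?n = fibre_size
    define hi where "hi x = uniform x * (f (x i) * s (x k))" for x
    define hj where "hj x = uniform x * (g (x j) * s (x k))" for x
    have split: "marg ?h A x = marg hi A x + marg hj A x" for A x
      by (simp add: marg_fibre edge_pair_def hi_def hj_def sum.distrib)
    have hi_0: "marg hi A x = 0" if "i \<notin> A" for A x
    proof (rule marg_eq_0[OF V(1) that])
      fix y assume "y \<in> X"
      then have "uniform (y(i := a)) = uniform y" if "a \<in> L i" for a
        using that V by (simp add: uniform_def config_upd)
      then show "(\<Sum>a\<in>L i. hi (y(i := a))) = 0"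
        using ne mean
        by (simp add: hi_def sum_distrib_left[symmetric] sum_distrib_right[symmetric])
    qed
    have hj_0: "marg hj A x = 0" if "j \<notin> A" for A x
    proof (rule marg_eq_0[OF V(2) that])
      fix y assume "y \<in> X"
      then have "uniform (y(j := a)) = uniform y" if "a \<in> L j" for a
        using that V by (simp add: uniform_def config_upd)
      then show "(\<Sum>a\<in>L j. hj (y(j := a))) = 0"
        using ne mean
        by (simp add: hj_def sum_distrib_left[symmetric] sum_distrib_right[symmetric])
    qed
    have hi_D: "marg hi (insert i D) x = ?n (insert i D) * hi x" if "x \<in> X" for x
      by (rule marg_of_dependent[OF _ that])
        (use D(3) in \<open>auto simp: depends_on_def hi_def uniform_def\<close>)
    have hj_D: "marg hj (insert j D) x = ?n (insert j D) * hj x" if "x \<in> X" for x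
      by (rule marg_of_dependent[OF _ that])
        (use D(3) in \<open>auto simp: depends_on_def hj_def uniform_def\<close>)
    have "defect w i j D ?h = (\<Sum>x\<in>X. ?n (insert i D) * ?n (insert j D)
        * (uniform x * (f (x i) * g (x j) * s (x k)))\<^sup>2)"
      unfolding defect_def split using ne D hi_0 hj_0 hi_D hj_D
      by (intro sum.cong) (auto simp: w_def hi_def hj_def power2_eq_square)
    also have "\<dots> > 0"
    proof -
      obtain z where z: "z \<in> X" using X_nonempty by blast
      obtain a b c where abc: "a \<in> L i" "b \<in> L j" "c \<in> L k" "f a \<noteq> 0" "g b \<noteq> 0" "s c \<noteq> 0"
        using nonzero by blast
      let ?x = "z(i := a, j := b, k := c)"
      have x: "?x \<in> X" using z abc V by (intro config_upd)
      have "0 < ?n (insert i D) * ?n (insert j D)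
          * (uniform ?x * (f (?x i) * g (?x j) * s (?x k)))\<^sup>2"
        using fibre_size_pos[of "insert i D"] fibre_size_pos[of "insert j D"] uniform_pos[OF x]
          abc ne by simp
      then show ?thesis
        by (intro sum_pos2[OF finite_X x]) (simp_all add: fibre_size_pos less_imp_le)
    qed
    finally show ?thesis .
  qed
  ultimately show False
    using card_X_pos fibre_size_pos[of D] fibre_size_pos[of "insert i (insert j D)"] by simp
qed

lemma mean_zero_function:
  assumes "v \<in> V"
  shows "\<exists>f :: 'a \<Rightarrow> real. sum f (L v) = 0 \<and> (\<exists>a\<in>L v. f a \<noteq> 0)"
proof -
  have "2 \<le> card (L v)" using assms state_space by (simp add: state_space_def)
  then obtain B where "B \<subseteq> L v" "card B = 2" by (rule obtain_subset_with_card_n)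
  then obtain a b where ab: "a \<in> L v" "b \<in> L v" "a \<noteq> b" by (auto simp: card_2_iff)
  let ?f = "\<lambda>x. (if x = a then 1 else 0) - (if x = b then 1 else 0) :: real"
  have "sum ?f (L v) = 0" using ab finite_L[OF assms] by (simp add: sum_subtractf)
  moreover have "\<exists>x\<in>L v. ?f x \<noteq> 0" using ab by (intro bexI[of _ a]) auto
  ultimately show ?thesis by blast
qed

section \<open>Separating sets at an unshielded triple\<close>

text \<open>
  By acyclicity at least one of the two vertices is not a descendant of the other, so the local
  Markov property applies with the other vertex's parents as the separating set.
\<close>

lemma nonadjacent_cond_indep:
  assumes G: "dag V G" and ij: "i \<in> V" "j \<in> V" "i \<noteq> j" "\<not> adjacent G i j"
  shows "(j, i) \<notin> G\<^sup>+ \<and> (\<forall>p\<in>bn_model V L G. cond_indep p i j (parents G j))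
    \<or> (i, j) \<notin> G\<^sup>+ \<and> (\<forall>p\<in>bn_model V L G. cond_indep p i j (parents G i))"
proof -
  have "(i, j) \<notin> G" "(j, i) \<notin> G" using ij(4) by (auto simp: adjacent_def)
  then have "cond_indep p i j (parents G j)" if "(j, i) \<notin> G\<^sup>+" "p \<in> bn_model V L G" for p
    using bn_model_cond_indep[OF G that(2) ij(1-3)] that(1) by blast
  moreover have "cond_indep p i j (parents G i)" if "(i, j) \<notin> G\<^sup>+" "p \<in> bn_model V L G" for p
    using bn_model_cond_indep[OF G that(2) ij(2,1) ij(3)[symmetric]] that(1)
      \<open>(j, i) \<notin> G\<close> cond_indep_sym[of p i j] by blast
  moreover have "(i, j) \<notin> G\<^sup>+ \<or> (j, i) \<notin> G\<^sup>+"
    using G unfolding dag_def acyclic_def by (meson trancl_trans)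
  ultimately show ?thesis by blast
qed

text \<open>
  The collider \<open>k\<close> is a child of both endpoints, hence a parent of neither.
\<close>

lemma collider_separator:
  assumes G: "dag V G" and coll: "unshielded_collider G i k j"
  shows "\<exists>S. i \<notin> S \<and> j \<notin> S \<and> k \<notin> S \<and> (\<forall>p\<in>bn_model V L G. cond_indep p i j S)"
proof -
  have ij: "i \<in> V" "j \<in> V" "i \<noteq> j" "\<not> adjacent G i j" and edges: "(i, k) \<in> G" "(j, k) \<in> G"
    using G coll by (auto simp: unshielded_collider_def dag_def)
  have "(k, i) \<notin> G" "(k, j) \<notin> G"
    using edges G unfolding dag_def acyclic_def by (meson r_into_trancl trancl_into_trancl)+
  then have k: "k \<notin> parents G i" "k \<notin> parents G j" by (auto simp: parents_def)
  have ends: "i \<notin> parents G j" "j \<notin> parents G i"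
    using ij by (auto simp: adjacent_def parents_def)
  obtain S where "S = parents G i \<or> S = parents G j" "\<forall>p\<in>bn_model V L G. cond_indep p i j S"
    using nonadjacent_cond_indep[OF G ij] by blast
  then show ?thesis
    by (intro exI[of _ S]) (use ends k not_own_parent[OF G] in auto)
qed

text \<open>
  If \<open>S\<close> consists of the parents of the later endpoint, \<open>k\<close> is one of them: otherwise that
  endpoint is a parent of \<open>k\<close>, and since \<open>k\<close> is no collider, the edge from \<open>k\<close> to the other
  endpoint makes the latter a descendant.
\<close>

lemma noncollider_separator:
  assumes G: "dag V G" and nonc: "unshielded_noncollider G i k j"
  shows "\<exists>S. i \<notin> S \<and> j \<notin> S \<and> k \<in> S \<and> (\<forall>p\<in>bn_model V L G. cond_indep p i j S)"
proof -
  have ij: "i \<in> V" "j \<in> V" "i \<noteq> j" "\<not> adjacent G i j"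
    and adj: "adjacent G i k" "adjacent G k j" and nc: "\<not> ((i, k) \<in> G \<and> (j, k) \<in> G)"
    using G nonc by (auto simp: unshielded_noncollider_def dag_def adjacent_def)
  have "k \<in> parents G j" if "(j, i) \<notin> G\<^sup>+"
  proof (rule ccontr)
    assume "k \<notin> parents G j"
    then have "(j, k) \<in> G" "(k, i) \<in> G"
      using adj nc by (auto simp: adjacent_def parents_def)
    then show False using that by (meson r_into_trancl trancl_into_trancl)
  qed
  moreover have "k \<in> parents G i" if "(i, j) \<notin> G\<^sup>+"
  proof (rule ccontr)
    assume "k \<notin> parents G i"
    then have "(i, k) \<in> G" "(k, j) \<in> G"
      using adj nc by (auto simp: adjacent_def parents_def)
    then show False using that by (meson r_into_trancl trancl_into_trancl)
  qed
  ultimately obtain S where "S = parents G i \<or> S = parents G j" "k \<in> S"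
      "\<forall>p\<in>bn_model V L G. cond_indep p i j S"
    using nonadjacent_cond_indep[OF G ij] by blast
  moreover have "i \<notin> parents G j" "j \<notin> parents G i"
    using ij by (auto simp: adjacent_def parents_def)
  ultimately show ?thesis
    by (intro exI[of _ S]) (use not_own_parent[OF G] in auto)
qed

end

theorem proposition4p6:
  fixes V :: "'v set" and L :: "'v \<Rightarrow> 'a set"
    and G1 G2 :: "('v \<times> 'v) set" and i j k :: 'v
  assumes "state_space V L"
    and "dag V G1" and "dag V G2"
    and "unshielded_collider G1 i k j"
    and "unshielded_noncollider G2 i k j"
    and "card (L k) = 2"
  shows "\<exists>\<theta>. overlap_at (bn_model V L G1) (bn_model V L G2) \<theta>"
proof -
  interpret discrete_variables V L
    using assms(1) by unfold_locales
  have V: "i \<in> V" "j \<in> V" "k \<in> V" and "i \<noteq> j"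
    using assms(2,4) by (auto simp: unshielded_collider_def dag_def)
  have ne: "i \<noteq> k" "j \<noteq> k"
    using assms(2,4) by (auto simp: unshielded_collider_def dag_def acyclic_def dest: r_into_trancl)
  have adj1: "adjacent G1 i k" "adjacent G1 j k"
    using assms(4) by (auto simp: unshielded_collider_def adjacent_def)
  have adj2: "adjacent G2 i k" "adjacent G2 j k"
    using assms(5) by (auto simp: unshielded_noncollider_def adjacent_def)
  obtain f :: "'a \<Rightarrow> real" where f: "sum f (L i) = 0" "\<exists>a\<in>L i. f a \<noteq> 0"
    using mean_zero_function[OF V(1)] by blast
  obtain g :: "'a \<Rightarrow> real" where g: "sum g (L j) = 0" "\<exists>a\<in>L j. g a \<noteq> 0"
    using mean_zero_function[OF V(2)] by blast
  obtain s :: "'a \<Rightarrow> real" where s: "sum s (L k) = 0" "\<exists>a\<in>L k. s a \<noteq> 0"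
    using mean_zero_function[OF V(3)] by blast
  let ?h = "edge_pair i j k f g s"
  note tangent1 = edge_pair_tangent[OF assms(2) V ne adj1 f(1) g(1) s(1)]
  note tangent2 = edge_pair_tangent[OF assms(3) V ne adj2 f(1) g(1) s(1)]
  obtain C where C: "i \<notin> C" "j \<notin> C" "k \<notin> C"
      "\<forall>p\<in>bn_model V L G1. cond_indep p i j C"
    using collider_separator[OF assms(2,4)] by blast
  obtain D where D: "i \<notin> D" "j \<notin> D" "k \<in> D"
      "\<forall>p\<in>bn_model V L G2. cond_indep p i j D"
    using noncollider_separator[OF assms(3,5)] by blast
  have "?h \<notin> tangent_cone (bn_model V L G1 \<inter> bn_model V L G2) uniform"
    by (rule edge_pair_not_tangent[OF V \<open>i \<noteq> j\<close> ne C(1-3) D(1-3) _ _ f(1) g(1) s(1) f(2) g(2) s(2)])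
      (use C(4) D(4) in auto)
  then have "overlap_at (bn_model V L G1) (bn_model V L G2) uniform"
    using tangent1 tangent2 unfolding overlap_at_def by blast
  then show ?thesis by blast
qed

end
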